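(* Let $M$ be a two-sided invertible $n\times n$ $q$-Manin matrix over $\mathfrak R$. Let $I=(i_1<i_2<\ldots<i_m)$ be a strictly increasing multi-index with entries in $\{1,\ldots,n\}$ and let $J=(j_1,\ldots,j_m)$ be an arbitrary multi-index with entries in $\{1,\ldots,n\}$. Then $$\det\nolimits_q(M)\,\det\nolimits_{q^{-1}}(M^{-1}_{IJ})=(-q)^{\sum_{l=1}^m(j_l-i_l)}\,\varepsilon^{q^{-1}}_J\,\det\nolimits_q(M_{\backslash J\,\backslash I}),$$ where $M^{-1}_{IJ}=(M^{-1})_{IJ}$. In particular, $$\det\nolimits_q(M)\,\det\nolimits_{q^{-1}}(M^{-1}_{IJ})=(-q)^{\sum_{l=1}^m(j_l-i_l)}\det\nolimits_q(M_{\backslash J\,\backslash I})\quad\text{if } j_1<j_2<\ldots<j_m,$$ $$\det\nolimits_q(M)\,\det\nolimits_{q^{-1}}(M^{-1}_{IJ})=0\quad\text{if } j_a=j_b\text{ for some }a\neq b.$$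
   Context: Let $q$ be a nonzero complex number and $\mathfrak R$ an associative unital, not necessarily commutative, algebra over $\mathbb C$. An $n\times m$ matrix $M=(M_{ij})$ over $\mathfrak R$ is called $q$-Manin if $M_{ij}M_{kj}=q^{-1}M_{kj}M_{ij}$ for all $j$ and all $i<k$, and $M_{ij}M_{kl}-M_{kl}M_{ij}=q^{-1}M_{kj}M_{il}-q\,M_{il}M_{kj}$ for all $i<k$, $j<l$. For any $p\in\mathbb C\setminus\{0\}$ the $p$-determinant of an $n\times n$ matrix $N$ over $\mathfrak R$ is $\det_p N=\sum_{\tau\in\mathfrak S_n}(-p)^{-\mathrm{inv}(\tau)}N_{\tau(1)1}N_{\tau(2)2}\cdots N_{\tau(n)n}$, where $\mathrm{inv}(\tau)$ is the number of inversions of $\tau$; the $p$-determinant of an empty matrix is $1$. "Two-sided invertible" means there is a matrix $M^{-1}$ over $\mathfrak R$ with $M^{-1}M=MM^{-1}=1$. For multi-indices $I=(i_1,\ldots,i_m)$, $J=(j_1,\ldots,j_m)$, $N_{IJ}$ is the $m\times m$ matrix with $(N_{IJ})_{ab}=N_{i_aj_b}$. $\backslash I$ denotes the increasing multi-index obtained by deleting $i_1,\ldots,i_m$ from $(1,2,\ldots,n)$. The symbol $\varepsilon^{q^{-1}}_J$ is defined by $\varepsilon^{q^{-1}}_J=0$ if $J$ has a repeated entry, and $\varepsilon^{q^{-1}}_{k_{\tau(1)},\ldots,k_{\tau(m)}}=(-q)^{\mathrm{inv}(\tau)}$ for $1\le k_1<\ldots<k_m\le n$ and $\tau\in\mathfrak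 S_m$. If $J$ has a repeated entry, the product $\varepsilon^{q^{-1}}_J\det_q(M_{\backslash J\backslash I})$ is interpreted as $0$. *)

theory Defs
  imports
    Complex_Main
    "HOL-Combinatorics.Permutations"
    "Jordan_Normal_Form.Matrix"
begin

(* Associative unital algebras over the complex numbers. The class is built on ring and
   monoid_mult rather than ring_1, since the latter would exclude the zero algebra. *)
class complex_algebra_1 = ring + monoid_mult +
  fixes scaleC :: "complex \<Rightarrow> 'a \<Rightarrow> 'a" (infixr \<open>*\<^sub>C\<close> 75)
  assumes scaleC_add_right: "c *\<^sub>C (x + y) = c *\<^sub>C x + c *\<^sub>C y"
    and scaleC_add_left: "(c + d) *\<^sub>C x = c *\<^sub>C x + d *\<^sub>C x"
    and scaleC_scaleC: "c *\<^sub>C d *\<^sub>C x = (c * d) *\<^sub>C x"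
    and scaleC_one: "1 *\<^sub>C x = x"
    and mult_scaleC_left: "(c *\<^sub>C x) * y = c *\<^sub>C (x * y)"
    and mult_scaleC_right: "x * (c *\<^sub>C y) = c *\<^sub>C (x * y)"

(* Rows, columns and the entries of multi-indices are numbered from 0, so the index set
   {1,...,n} becomes {0..<n}; multi-indices are lists. *)

definition q_Manin :: "complex \<Rightarrow> 'a::complex_algebra_1 mat \<Rightarrow> bool" where
  "q_Manin q M \<longleftrightarrow>
     (\<forall>j < dim_col M. \<forall>i < dim_row M. \<forall>k < dim_row M. i < k \<longrightarrow>
        M $$ (i,j) * M $$ (k,j) = inverse q *\<^sub>C (M $$ (k,j) * M $$ (i,j))) \<and>
     (\<forall>i < dim_row M. \<forall>k < dim_row M. \<forall>j < dim_col M. \<forall>l < dim_col M. i < k \<longrightarrow> j < l \<longrightarrow>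
        M $$ (i,j) * M $$ (k,l) - M $$ (k,l) * M $$ (i,j) =
          inverse q *\<^sub>C (M $$ (k,j) * M $$ (i,l)) - q *\<^sub>C (M $$ (i,l) * M $$ (k,j)))"

definition inversions :: "nat \<Rightarrow> (nat \<Rightarrow> nat) \<Rightarrow> nat" where
  "inversions n \<tau> = card {(a, b). a < b \<and> b < n \<and> \<tau> b < \<tau> a}"

(* The p-determinant; intended for square matrices. The list product fixes the order of the
   factors: column 0 first. *)
definition p_det :: "complex \<Rightarrow> 'a::complex_algebra_1 mat \<Rightarrow> 'a" where
  "p_det p N =
     (\<Sum>\<tau> | \<tau> permutes {0..<dim_col N}.
        ((- p) powi (- int (inversions (dim_col N) \<tau>))) *\<^sub>C
          prod_list (map (\<lambda>j. N $$ (\<tau> j, j)) [0..<dim_col N]))"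

definition multi_submat :: "'a mat \<Rightarrow> nat list \<Rightarrow> nat list \<Rightarrow> 'a mat" where
  "multi_submat N I J = mat (length I) (length J) (\<lambda>(a, b). N $$ (I ! a, J ! b))"

definition compl_index :: "nat \<Rightarrow> nat list \<Rightarrow> nat list" where
  "compl_index n I = filter (\<lambda>k. k \<notin> set I) [0..<n]"

(* The symbol epsilon with superscript q^(-1). If J has no repeated entry, then J consists of
   k_(tau 1), ..., k_(tau m) for the increasing sequence k = sort J and a unique tau. *)
definition eps_qinv :: "complex \<Rightarrow> nat list \<Rightarrow> complex" where
  "eps_qinv q J =
     (if distinct J
      then (- q) ^ inversions (length J)
             (THE \<tau>. \<tau> permutes {0..<length J} \<and> (\<forall>a < length J. J ! a = sort J ! \<tau> a))
      else 0)"

lemma eps_qinv_not_distinct: "\<not> distinct J \<Longrightarrow> eps_qinv q J = 0"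
  by (simp add: eps_qinv_def)

lemma eps_qinv_permute:
  assumes k: "sorted_wrt (<) k" and t: "\<tau> permutes {0..<length k}"
  shows "eps_qinv q (map (\<lambda>a. k ! \<tau> a) [0..<length k]) = (- q) ^ inversions (length k) \<tau>"
proof -
  define J where "J = map (\<lambda>a. k ! \<tau> a) [0..<length k]"
  have len: "length J = length k" by (simp add: J_def)
  have dk: "distinct k" and sk: "sorted k" using k by (auto simp: strict_sorted_iff)
  have lt: "\<tau> a < length k" if "a < length k" for a
    using permutes_in_image[OF t, of a] that by simp
  have "inj_on (\<lambda>a. k ! \<tau> a) {0..<length k}"
  proof (rule inj_onI)
    fix a b assume "a \<in> {0..<length k}" "b \<in> {0..<length k}" "k ! \<tau> a = k ! \<tau> b"
    then have "\<tau> a = \<tau> b" using dk lt nth_eq_iff_index_eq[OF dk] by simp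
    then show "a = b" using permutes_inj[OF t] by (rule injD[rotated])
  qed
  then have dJ: "distinct J" by (simp add: J_def distinct_map)
  have "set J = (\<lambda>a. k ! a) ` (\<tau> ` {0..<length k})" by (auto simp: J_def)
  also have "\<dots> = set k"
    unfolding permutes_image[OF t] by (metis list.set_map map_nth set_upt)
  finally have setJ: "set J = set k" .
  have sJ: "sort J = k"
    by (rule sorted_distinct_set_unique) (simp_all add: setJ dJ dk sk)
  have "(THE \<sigma>. \<sigma> permutes {0..<length J} \<and> (\<forall>a < length J. J ! a = sort J ! \<sigma> a)) = \<tau>"
  proof (rule the_equality)
    show "\<tau> permutes {0..<length J} \<and> (\<forall>a < length J. J ! a = sort J ! \<tau> a)"
      using t unfolding sJ len by (simp add: J_def)
  next
    fix \<sigma> assume s: "\<sigma> permutes {0..<length J} \<and> (\<forall>a < length J. J ! a = sort J ! \<sigma> a)"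
    show "\<sigma> = \<tau>"
    proof
      fix a show "\<sigma> a = \<tau> a"
      proof (cases "a < length k")
        case True
        then have "k ! \<sigma> a = k ! \<tau> a" using s unfolding sJ len by (simp add: J_def)
        moreover have "\<sigma> a < length k"
          using permutes_in_image[of \<sigma> "{0..<length k}" a] s True by (simp add: len)
        ultimately show ?thesis using nth_eq_iff_index_eq[OF dk _ lt[OF True]] by simp
      next
        case False
        then show ?thesis using s permutes_not_in[OF t, of a] permutes_not_in[of \<sigma> "{0..<length k}" a] by (simp add: len)
      qed
    qed
  qed
  then show ?thesis using dJ len unfolding eps_qinv_def J_def by simp
qed

end

theory Submission
  imports Defs
begin

text \<open>
  The argument is best seen in the \<open>q\<close>-Grassmann algebra with generators \<open>\<psi>\<^sub>0, \<dots>, \<psi>\<^sub>n\<^sub>-\<^sub>1\<close>,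
  which square to zero, satisfy \<open>\<psi>\<^sub>l \<psi>\<^sub>j = - q\<inverse> \<psi>\<^sub>j \<psi>\<^sub>l\<close> for \<open>j < l\<close> and commute with the
  coefficients. A matrix \<open>M\<close> is \<open>q\<close>-Manin exactly when the elements \<open>\<phi>\<^sub>c = \<Sum>\<^sub>k \<psi>\<^sub>k M\<^sub>k\<^sub>c\<close>
  satisfy the same relations, and then \<open>\<phi>\<^sub>0 \<cdots> \<phi>\<^sub>n\<^sub>-\<^sub>1 = \<psi>\<^sub>0 \<cdots> \<psi>\<^sub>n\<^sub>-\<^sub>1 det\<^sub>q M\<close>.
  Let \<open>C\<close> be the complement of \<open>I\<close>. The product \<open>\<phi>\<^sub>C \<psi>\<^sub>j\<^sub>m \<cdots> \<psi>\<^sub>j\<^sub>1\<close> has degree \<open>n\<close>, and its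
  top coefficient can be found in two ways.

  Expanding \<open>\<phi>\<^sub>C\<close> in the \<open>\<psi>\<^sub>k\<close>, only words in the complement of \<open>J\<close> survive. They give the
  complementary minor of \<open>M\<close>, up to a power of \<open>- q\<close>, or zero if \<open>J\<close> has a repeated entry
  (\<open>pullback_q_sign_append_rev\<close>).
  Expanding instead \<open>\<psi>\<^sub>j = \<Sum>\<^sub>c \<phi>\<^sub>c (M\<inverse>)\<^sub>c\<^sub>j\<close> one factor at a time, the coefficients appear in the
  order \<open>(M\<inverse>)\<^sub>c\<^sub>1\<^sub>j\<^sub>1 \<cdots> (M\<inverse>)\<^sub>c\<^sub>m\<^sub>j\<^sub>m\<close>, which is why the factors \<open>\<psi>\<^sub>j\<close> are multiplied in reverse;
  only rearrangements of \<open>I\<close> survive. The result is \<open>det\<^sub>q M\<close> times a minor of \<open>M\<inverse>\<close>, up to a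
  power of \<open>- q\<close>; and since reversing a word turns inversions into non-inversions, that minor is
  the \<open>q\<inverse>\<close>-determinant (\<open>det_mult_det_inverse_conv_pullback\<close>).
  Counting inversions compares the two powers (\<open>inv_count_rev\<close>, \<open>sum_card_complement\<close>).

  The Grassmann algebra enters only through its multilinear functions: a word stands for a
  product of generators, \<open>q_sign\<close> reads off the top coefficient of such a product, and \<open>pullback\<close>
  substitutes \<open>\<phi>\<close> for \<open>\<psi>\<close>. That the \<open>\<phi>\<^sub>c\<close> satisfy the relations becomes the statement that
  pulling back along \<open>M\<close> preserves functions which alternate up to the factor \<open>- q\<inverse>\<close>
  (\<open>q_alternating_pullback\<close>).
\<close>

section \<open>Scalars\<close>

lemma scaleC_zero_right [simp]: "c *\<^sub>C (0::'a::complex_algebra_1) = 0"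
  using scaleC_add_right[of c "0::'a" 0] by simp

lemma scaleC_zero_left [simp]: "0 *\<^sub>C (x::'a::complex_algebra_1) = 0"
  using scaleC_add_left[of 0 0 x] by simp

lemma scaleC_minus_left: "(- c) *\<^sub>C (x::'a::complex_algebra_1) = - (c *\<^sub>C x)"
  using scaleC_add_left[of c "- c" x] by (simp add: eq_neg_iff_add_eq_0 add.commute)

lemma scaleC_minus_right: "c *\<^sub>C (- x::'a::complex_algebra_1) = - (c *\<^sub>C x)"
  using scaleC_add_right[of c x "- x"] by (simp add: eq_neg_iff_add_eq_0 add.commute)

lemma scaleC_diff_right: "c *\<^sub>C (x - y::'a::complex_algebra_1) = c *\<^sub>C x - c *\<^sub>C y"
  using scaleC_add_right[of c x "- y"] by (simp add: scaleC_minus_right)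

lemma scaleC_sum: "c *\<^sub>C (\<Sum>i\<in>S. f i) = (\<Sum>i\<in>S. c *\<^sub>C (f i :: 'a::complex_algebra_1))"
  by (induction S rule: infinite_finite_induct) (auto simp: scaleC_add_right)

lemma scaleC_left_cancel:
  assumes "c \<noteq> 0" "c *\<^sub>C x = c *\<^sub>C (y::'a::complex_algebra_1)"
  shows "x = y"
  using arg_cong[OF assms(2), of "\<lambda>z. inverse c *\<^sub>C z"] assms(1)
  by (simp add: scaleC_scaleC scaleC_one)

section \<open>Inversions of words\<close>

fun inv_count :: "nat list \<Rightarrow> nat" where
  "inv_count [] = 0"
| "inv_count (x # xs) = length (filter (\<lambda>y. y < x) xs) + inv_count xs"

lemma inv_count_conv_card:
  "inv_count xs = card {(a, b). a < b \<and> b < length xs \<and> xs ! b < xs ! a}"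
proof (induction xs)
  case (Cons x xs)
  let ?S = "{(a, b). a < b \<and> b < length xs \<and> xs ! b < xs ! a}"
  let ?T = "{b. b < length xs \<and> xs ! b < x}"
  have fin: "finite ?S"
    by (rule finite_subset[of _ "{..<length xs} \<times> {..<length xs}"]) auto
  have "{(a, b). a < b \<and> b < length (x # xs) \<and> (x # xs) ! b < (x # xs) ! a}
      = (\<lambda>b. (0, Suc b)) ` ?T \<union> map_prod Suc Suc ` ?S" (is "?L = ?R")
  proof (intro equalityI subsetI)
    fix p assume "p \<in> ?L"
    then show "p \<in> ?R"
      by (cases p; cases "fst p"; cases "snd p") (auto simp: image_iff)
  qed auto
  moreover have "card ?R = card ?T + card ?S"
    using fin by (subst card_Un_disjoint) (auto simp: card_image inj_on_def)
  ultimately show ?case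
    using Cons.IH by (simp add: length_filter_conv_card)
qed simp

lemma inv_count_swap:
  "b < a \<Longrightarrow> inv_count (u @ a # b # v) = Suc (inv_count (u @ b # a # v))"
  by (induction u) auto

lemma inv_count_append:
  "distinct (xs @ ys) \<Longrightarrow>
   inv_count (xs @ ys) = inv_count xs + inv_count ys + (\<Sum>x\<in>set xs. card {y \<in> set ys. y < x})"
proof (induction xs)
  case (Cons x xs)
  have "length (filter (\<lambda>y. y < x) ys) = card {y \<in> set ys. y < x}"
    using Cons.prems by (metis distinct_append distinct_card distinct_filter set_filter)
  then show ?case using Cons by simp
qed simp

lemma inv_count_snoc: "inv_count (xs @ [x]) = inv_count xs + length (filter (\<lambda>y. x < y) xs)"
  by (induction xs) auto

text \<open>Every pair of positions is an inversion of exactly one of a word and its reversal,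
  as long as no letter is repeated.\<close>

lemma inv_count_rev: "distinct xs \<Longrightarrow> inv_count (rev xs) + inv_count xs = length xs choose 2"
proof (induction xs)
  case (Cons x xs)
  have "length (filter (\<lambda>y. x < y) xs) + length (filter (\<lambda>y. y < x) xs) = length xs"
    using Cons.prems by (induction xs) auto
  moreover have "length (filter (\<lambda>y. x < y) (rev xs)) = length (filter (\<lambda>y. x < y) xs)"
    by (simp flip: rev_filter)
  ultimately show ?case
    using Cons by (simp add: inv_count_snoc numeral_2_eq_2)
qed (simp add: numeral_2_eq_2)

lemma inv_count_strict_sorted: "sorted_wrt (<) xs \<Longrightarrow> inv_count xs = 0"
  by (induction xs) (auto simp: filter_empty_conv)

lemma inv_count_permute_list:
  assumes R: "sorted_wrt (<) R" and t: "\<tau> permutes {0..<length R}"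
  shows "inv_count (permute_list \<tau> R) = inversions (length R) \<tau>"
proof -
  have t': "\<tau> permutes {..<length R}" using t by (simp add: atLeast0LessThan)
  have lt: "\<tau> a < length R" if "a < length R" for a
    using permutes_in_image[OF t, of a] that by simp
  have mono: "R ! x < R ! y \<longleftrightarrow> x < y" if "x < length R" "y < length R" for x y
    using R that by (metis linorder_neqE_nat less_asym less_irrefl sorted_wrt_nth_less)
  have "{(a, b). a < b \<and> b < length R \<and> permute_list \<tau> R ! b < permute_list \<tau> R ! a}
      = {(a, b). a < b \<and> b < length R \<and> \<tau> b < \<tau> a}"
    using t' lt mono by (auto simp: permute_list_nth)
  then show ?thesis by (simp add: inv_count_conv_card inversions_def)
qed

lemma eps_qinv_conv_inv_count:
  assumes "distinct J"
  shows "eps_qinv q J = (- q) ^ inv_count J"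
proof -
  have "mset J = mset (sort J)" by simp
  then obtain \<tau> where t: "\<tau> permutes {..<length (sort J)}" "permute_list \<tau> (sort J) = J"
    by (rule mset_eq_permutation)
  have s: "sorted_wrt (<) (sort J)" using assms by (simp add: strict_sorted_iff)
  have t0: "\<tau> permutes {0..<length (sort J)}" using t(1) by (simp add: atLeast0LessThan)
  show ?thesis
    using eps_qinv_permute[OF s t0, of q] inv_count_permute_list[OF s t0] t(2)
    by (simp add: permute_list_def)
qed

lemma sum_card_less_within:
  "finite (S::nat set) \<Longrightarrow> (\<Sum>x\<in>S. card {y \<in> S. y < x}) = card S choose 2"
proof (induction S rule: finite_linorder_max_induct)
  case (insert m S)
  have "{y \<in> insert m S. y < m} = S" using insert by auto
  moreover have "{y \<in> insert m S. y < x} = {y \<in> S. y < x}" if "x \<in> S" for x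
    using insert that by force
  moreover have "m \<notin> S" using insert by auto
  ultimately show ?case using insert by (simp add: numeral_2_eq_2)
qed (simp add: numeral_2_eq_2)

text \<open>Count the pairs \<open>y < x < n\<close> with \<open>y \<in> S\<close> in two ways: for given \<open>y\<close> there are
  \<open>n - 1 - y\<close> values of \<open>x\<close>; and \<open>card S choose 2\<close> of the pairs lie inside \<open>S\<close>. For sets of
  equal size, the number of pairs that leave \<open>S\<close> thus depends only on \<open>\<Sum>S\<close>, which is where the
  exponent \<open>\<Sum>\<^sub>l (j\<^sub>l - i\<^sub>l)\<close> comes from.\<close>

lemma sum_card_complement:
  assumes "S \<subseteq> {..<n::nat}"
  shows "(\<Sum>x\<in>{..<n} - S. card {y \<in> S. y < x}) + (card S choose 2) + card S + \<Sum>S = card S * n"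
proof -
  have fin: "finite S" using assms finite_subset by blast
  have "(\<Sum>x\<in>{..<n} - S. card {y \<in> S. y < x}) + (\<Sum>x\<in>S. card {y \<in> S. y < x})
      = (\<Sum>x<n. card {y \<in> S. y < x})"
    using assms by (simp add: sum.subset_diff)
  also have "\<dots> = (\<Sum>x<n. \<Sum>y\<in>S. if y < x then 1 else 0)"
    using fin by (simp add: sum.If_cases Int_def)
  also have "\<dots> = (\<Sum>y\<in>S. \<Sum>x<n. if y < x then 1 else 0)" by (rule sum.swap)
  also have "\<dots> = (\<Sum>y\<in>S. n - 1 - y)"
  proof (rule sum.cong[OF refl])
    fix y assume "y \<in> S"
    have "{..<n} \<inter> {x. y < x} = {y<..<n}" by auto
    then show "(\<Sum>x<n. if y < x then 1 else 0) = n - 1 - y" by (simp add: sum.If_cases)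
  qed
  finally have *: "(\<Sum>x\<in>{..<n} - S. card {y \<in> S. y < x}) + (card S choose 2) = (\<Sum>y\<in>S. n - 1 - y)"
    using fin by (simp add: sum_card_less_within)
  have "(\<Sum>y\<in>S. n - 1 - y) + card S + \<Sum>S = (\<Sum>y\<in>S. (n - 1 - y) + 1 + y)"
    by (simp only: sum.distrib card_eq_sum)
  also have "\<dots> = (\<Sum>y\<in>S. n)" using assms by (intro sum.cong) auto
  finally show ?thesis using * by simp
qed

section \<open>Functions of words that are alternating up to a scalar\<close>

definition q_alternating :: "complex \<Rightarrow> nat \<Rightarrow> (nat list \<Rightarrow> 'a::complex_algebra_1) \<Rightarrow> bool" where
  "q_alternating r n f \<longleftrightarrow>
     (\<forall>u a v. set (u @ a # v) \<subseteq> {..<n} \<longrightarrow> f (u @ a # a # v) = 0) \<and>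
     (\<forall>u a b v. set (u @ a # b # v) \<subseteq> {..<n} \<longrightarrow> b < a \<longrightarrow>
        f (u @ a # b # v) = r *\<^sub>C f (u @ b # a # v))"

lemma q_alternatingD:
  assumes "q_alternating r n f"
  shows "set (u @ a # v) \<subseteq> {..<n} \<Longrightarrow> f (u @ a # a # v) = 0"
    and "set (u @ a # b # v) \<subseteq> {..<n} \<Longrightarrow> b < a \<Longrightarrow> f (u @ a # b # v) = r *\<^sub>C f (u @ b # a # v)"
  using assms unfolding q_alternating_def by simp_all

lemma not_strict_sorted_split:
  "\<not> sorted_wrt (<) (xs::nat list) \<Longrightarrow> \<exists>u a b v. xs = u @ a # b # v \<and> b \<le> a"
proof (induction xs)
  case (Cons x xs)
  show ?case
  proof (cases "sorted_wrt (<) xs")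
    case True
    then obtain b v where "xs = b # v" "b \<le> x"
      using Cons.prems by (cases xs) (auto simp: not_less intro: less_trans)
    then have "x # xs = [] @ x # b # v \<and> b \<le> x" by simp
    then show ?thesis by blast
  next
    case False
    then obtain u a b v where "xs = u @ a # b # v" "b \<le> a" using Cons.IH by blast
    then have "x # xs = (x # u) @ a # b # v \<and> b \<le> a" by simp
    then show ?thesis by blast
  qed
qed simp

text \<open>Bubble sort: as long as the word has an adjacent weak descent, either its two letters are
  equal and the value is zero, or swapping them costs a factor \<open>r\<close> and removes one inversion.\<close>

lemma q_alternating_sort:
  assumes "q_alternating r n f" and "set D \<subseteq> {..<n}"
  shows "f D = (if distinct D then r ^ inv_count D *\<^sub>C f (sort D) else 0)"
  using assms(2)
proof (induction "inv_count D" arbitrary: D rule: less_induct)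
  case less
  show ?case
  proof (cases "sorted_wrt (<) D")
    case True
    then show ?thesis
      by (simp add: inv_count_strict_sorted scaleC_one strict_sorted_iff sorted_sort_id)
  next
    case False
    then obtain u a b v where D: "D = u @ a # b # v" and "b \<le> a"
      using not_strict_sorted_split by blast
    show ?thesis
    proof (cases "b = a")
      case True
      then show ?thesis using q_alternatingD(1)[OF assms(1), of u a v] less.prems D by simp
    next
      case False
      then have ba: "b < a" using \<open>b \<le> a\<close> by simp
      let ?E = "u @ b # a # v"
      have inv: "inv_count D = Suc (inv_count ?E)" unfolding D by (rule inv_count_swap[OF ba])
      have ms: "mset ?E = mset D" unfolding D by simp
      have "f ?E = (if distinct ?E then r ^ inv_count ?E *\<^sub>C f (sort ?E) else 0)"
        using less.hyps[of ?E] inv less.prems D by auto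
      moreover have "sort ?E = sort D"
        by (rule properties_for_sort) (simp_all add: ms[symmetric])
      moreover have "distinct ?E = distinct D" using ms by (rule mset_eq_imp_distinct_iff)
      moreover have "f D = r *\<^sub>C f ?E"
        using q_alternatingD(2)[OF assms(1), of u a b v] less.prems ba D by simp
      ultimately show ?thesis using inv by (simp add: scaleC_scaleC)
    qed
  qed
qed

text \<open>The coefficient of \<open>\<psi>\<^sub>0 \<cdots> \<psi>\<^sub>n\<^sub>-\<^sub>1\<close> in the product of generators spelled by a word of
  length \<open>n\<close>. It is defined for words of any length, so that \<open>n\<close> need not be an argument.\<close>

definition q_sign :: "complex \<Rightarrow> nat list \<Rightarrow> 'a::complex_algebra_1" where
  "q_sign r w = (if distinct w then r ^ inv_count w *\<^sub>C 1 else 0)"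

lemma q_alternating_q_sign: "q_alternating r n (q_sign r :: nat list \<Rightarrow> 'a::complex_algebra_1)"
  unfolding q_alternating_def
proof (intro conjI allI impI)
  fix u v :: "nat list" and a b :: nat assume "b < a"
  moreover have "distinct (u @ a # b # v) = distinct (u @ b # a # v)" by auto
  ultimately show "q_sign r (u @ a # b # v) = r *\<^sub>C (q_sign r (u @ b # a # v) :: 'a)"
    by (simp only: q_sign_def inv_count_swap) (simp add: scaleC_scaleC)
qed (simp add: q_sign_def)

section \<open>Pulling back along a matrix\<close>

definition words :: "nat \<Rightarrow> nat \<Rightarrow> nat list set" where
  "words n m = {K. set K \<subseteq> {..<n} \<and> length K = m}"

definition word_prod :: "'a::complex_algebra_1 mat \<Rightarrow> nat list \<Rightarrow> nat list \<Rightarrow> 'a" where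
  "word_prod A K C = prod_list (map2 (\<lambda>k c. A $$ (k, c)) K C)"

text \<open>The coefficient \<open>e K\<close> stands on the left of the matrix entries. Peeling off the first
  column then multiplies \<open>e\<close> by entries from the right (\<open>pullback_Cons\<close>), and \<open>e\<close> never has to be
  commuted past an entry.\<close>

definition pullback :: "'a mat \<Rightarrow> nat \<Rightarrow> (nat list \<Rightarrow> 'a) \<Rightarrow> nat list \<Rightarrow> 'a::complex_algebra_1" where
  "pullback A n e C = (\<Sum>K\<in>words n (length C). e K * word_prod A K C)"

lemma finite_words [simp]: "finite (words n m)"
  unfolding words_def by (rule finite_lists_length_eq) simp

lemma words_0 [simp]: "words n 0 = {[]}"
  by (auto simp: words_def)

lemma sum_words_Suc: "(\<Sum>K\<in>words n (Suc m). g K) = (\<Sum>k<n. \<Sum>K\<in>words n m. g (k # K))"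
proof -
  have "words n (Suc m) = (\<lambda>(k, K). k # K) ` ({..<n} \<times> words n m)"
    by (auto simp: words_def length_Suc_conv image_iff)
  moreover have "inj_on (\<lambda>(k, K). k # K) ({..<n} \<times> words n m)"
    by (auto simp: inj_on_def)
  ultimately show ?thesis
    by (simp add: sum.reindex sum.cartesian_product case_prod_unfold)
qed

lemma pullback_Nil [simp]: "pullback A n e [] = e []"
  by (simp add: pullback_def word_prod_def)

lemma pullback_Cons:
  "pullback A n e (c # C) = pullback A n (\<lambda>w. \<Sum>k<n. e (k # w) * A $$ (k, c)) C"
  unfolding pullback_def
  by (simp add: sum_words_Suc word_prod_def sum_distrib_right mult.assoc)
    (rule sum.swap)

lemma pullback_cong:
  "(\<And>w. set w \<subseteq> {..<n} \<Longrightarrow> e w = e' w) \<Longrightarrow> pullback A n e C = pullback A n e' C"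
  unfolding pullback_def by (intro sum.cong) (auto simp: words_def)

lemma pullback_scaleC: "pullback A n (\<lambda>w. r *\<^sub>C e w) C = r *\<^sub>C pullback A n e C"
  unfolding pullback_def by (simp add: scaleC_sum mult_scaleC_left)

lemma pullback_zero: "pullback A n (\<lambda>w. 0) C = 0"
  unfolding pullback_def by simp

text \<open>Fold the part \<open>x > y\<close> of the sum onto the part \<open>x < y\<close>.\<close>

lemma sum_q_antisymmetric:
  fixes E G :: "nat \<Rightarrow> nat \<Rightarrow> 'a::complex_algebra_1"
  assumes diag: "\<And>x. x < n \<Longrightarrow> E x x = 0"
    and swap: "\<And>x y. x < y \<Longrightarrow> y < n \<Longrightarrow> E y x = r *\<^sub>C E x y"
  shows "(\<Sum>y<n. \<Sum>x<n. E x y * G x y) = (\<Sum>y<n. \<Sum>x<y. E x y * (G x y + r *\<^sub>C G y x))"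
proof -
  have "(\<Sum>y<n. \<Sum>x<n. E x y * G x y)
      = (\<Sum>y<n. (\<Sum>x<y. E x y * G x y) + (\<Sum>x\<in>{y<..<n}. E x y * G x y))"
  proof (rule sum.cong[OF refl])
    fix y assume y: "y \<in> {..<n}"
    have "(\<Sum>x<n. E x y * G x y) = (\<Sum>x\<in>{..<y} \<union> {y<..<n}. E x y * G x y)"
      using y by (intro sum.mono_neutral_right) (auto simp: diag not_less le_less)
    also have "\<dots> = (\<Sum>x<y. E x y * G x y) + (\<Sum>x\<in>{y<..<n}. E x y * G x y)"
      by (rule sum.union_disjoint) auto
    finally show "(\<Sum>x<n. E x y * G x y) = \<dots>" .
  qed
  also have "\<dots> = (\<Sum>y<n. \<Sum>x<y. E x y * G x y) + (\<Sum>y<n. \<Sum>x\<in>{y<..<n}. E x y * G x y)"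
    by (rule sum.distrib)
  also have "(\<Sum>y<n. \<Sum>x\<in>{y<..<n}. E x y * G x y) = (\<Sum>x<n. \<Sum>y<x. E x y * G x y)"
    unfolding sum.Sigma[OF finite_lessThan ballI[OF finite_greaterThanLessThan]]
      sum.Sigma[OF finite_lessThan ballI[OF finite_lessThan]]
    by (rule sum.reindex_bij_witness[of _ "\<lambda>(x, y). (y, x)" "\<lambda>(x, y). (y, x)"]) auto
  also have "\<dots> = (\<Sum>y<n. \<Sum>x<y. E x y * (r *\<^sub>C G y x))"
    by (intro sum.cong refl) (simp add: swap mult_scaleC_left mult_scaleC_right)
  finally show ?thesis by (simp add: sum.distrib distrib_left)
qed

text \<open>A pair of rows \<open>x < y\<close> contributes \<open>M\<^sub>x\<^sub>a M\<^sub>y\<^sub>b - q\<inverse> M\<^sub>y\<^sub>a M\<^sub>x\<^sub>b\<close>, and the \<open>q\<close>-Manin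
  relations say precisely that this expression vanishes for \<open>a = b\<close> and takes the factor
  \<open>- q\<inverse>\<close> when two columns \<open>b < a\<close> are put in increasing order.\<close>

lemma q_Manin_pair_sum:
  fixes M :: "'a::complex_algebra_1 mat"
  assumes q: "q \<noteq> 0" and M: "M \<in> carrier_mat n n" "q_Manin q M"
    and r: "r = inverse (- q)"
    and diag: "\<And>x. x < n \<Longrightarrow> E x x = 0"
    and swap: "\<And>x y. x < y \<Longrightarrow> y < n \<Longrightarrow> E y x = r *\<^sub>C E x y"
    and a: "a < n"
  shows "(\<Sum>y<n. \<Sum>x<n. E x y * (M $$ (x, a) * M $$ (y, a))) = 0"
    and "b < a \<Longrightarrow> (\<Sum>y<n. \<Sum>x<n. E x y * (M $$ (x, a) * M $$ (y, b)))
           = r *\<^sub>C (\<Sum>y<n. \<Sum>x<n. E x y * (M $$ (x, b) * M $$ (y, a)))"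
proof -
  have ri: "r = - inverse q" using r by simp
  have "M $$ (x, a) * M $$ (y, a) + r *\<^sub>C (M $$ (y, a) * M $$ (x, a)) = 0"
    if "x < y" "y < n" for x y
    using that a M unfolding q_Manin_def ri by (auto simp: scaleC_minus_left)
  then show "(\<Sum>y<n. \<Sum>x<n. E x y * (M $$ (x, a) * M $$ (y, a))) = 0"
    by (subst sum_q_antisymmetric[where r = r]) (auto simp: diag swap)
next
  assume b: "b < a"
  have ri: "r = - inverse q" using r by simp
  have "M $$ (x, a) * M $$ (y, b) + r *\<^sub>C (M $$ (y, a) * M $$ (x, b))
      = r *\<^sub>C (M $$ (x, b) * M $$ (y, a) + r *\<^sub>C (M $$ (y, b) * M $$ (x, a)))"
    if "x < y" "y < n" for x y
  proof -
    have "M $$ (x, b) * M $$ (y, a) - M $$ (y, a) * M $$ (x, b)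
        = inverse q *\<^sub>C (M $$ (y, b) * M $$ (x, a)) - q *\<^sub>C (M $$ (x, a) * M $$ (y, b))"
      using M a b that unfolding q_Manin_def by auto
    \<comment> \<open>The claim multiplied by \<open>q\<close> is a rearrangement of this relation.\<close>
    from arg_cong[OF this, of "\<lambda>z. inverse q *\<^sub>C z"] show ?thesis
      using q unfolding ri
      by (simp add: scaleC_diff_right scaleC_add_right scaleC_minus_left scaleC_minus_right
          scaleC_scaleC scaleC_one algebra_simps)
  qed
  then show "(\<Sum>y<n. \<Sum>x<n. E x y * (M $$ (x, a) * M $$ (y, b)))
           = r *\<^sub>C (\<Sum>y<n. \<Sum>x<n. E x y * (M $$ (x, b) * M $$ (y, a)))"
    by (subst (1 2) sum_q_antisymmetric[where r = r])
      (auto simp: diag swap scaleC_sum mult_scaleC_right intro!: sum.cong)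
qed

text \<open>Absorbing the columns \<open>u\<close> on the left into \<open>e\<close> keeps \<open>e\<close> alternating, so only the case where
  the two adjacent columns come first needs the \<open>q\<close>-Manin relations.\<close>

lemma pullback_adjacent_columns:
  fixes M :: "'a::complex_algebra_1 mat"
  assumes q: "q \<noteq> 0" and M: "M \<in> carrier_mat n n" "q_Manin q M"
    and r: "r = inverse (- q)"
    and e: "q_alternating r n e" and a: "a < n"
  shows "pullback M n e (u @ a # a # v) = 0"
    and "b < a \<Longrightarrow> pullback M n e (u @ a # b # v) = r *\<^sub>C pullback M n e (u @ b # a # v)"
proof -
  have two: "pullback M n e (c # d # v) =
      pullback M n (\<lambda>w. \<Sum>y<n. \<Sum>x<n. e (x # y # w) * (M $$ (x, c) * M $$ (y, d))) v" for c d e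
    by (simp add: pullback_Cons sum_distrib_right mult.assoc)
  have diag: "e (x # x # w) = 0"
    if "q_alternating r n e" "set w \<subseteq> {..<n}" "x < n" for e :: "nat list \<Rightarrow> 'a" and x w
    using q_alternatingD(1)[OF that(1), of "[]" x w] that by simp
  have swap: "e (y # x # w) = r *\<^sub>C e (x # y # w)"
    if "q_alternating r n e" "set w \<subseteq> {..<n}" "x < y" "y < n" for e :: "nat list \<Rightarrow> 'a" and x y w
    using q_alternatingD(2)[OF that(1), of "[]" y x w] that by simp
  have step: "q_alternating r n (\<lambda>w. \<Sum>k<n. e (k # w) * M $$ (k, c))"
    if "q_alternating r n e" for e c
    unfolding q_alternating_def
  proof (intro conjI allI impI)
    fix u a v assume s: "set (u @ a # v) \<subseteq> {..<n}"
    show "(\<Sum>k<n. e (k # u @ a # a # v) * M $$ (k, c)) = 0"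
      using q_alternatingD(1)[OF that, of "_ # u" a v] s by (intro sum.neutral) simp
  next
    fix u a b v assume s: "set (u @ a # b # v) \<subseteq> {..<n}" and "b < a"
    then show "(\<Sum>k<n. e (k # u @ a # b # v) * M $$ (k, c))
        = r *\<^sub>C (\<Sum>k<n. e (k # u @ b # a # v) * M $$ (k, c))"
      using q_alternatingD(2)[OF that, of "_ # u" a b v]
      by (simp add: scaleC_sum mult_scaleC_left[symmetric])
  qed
  show "pullback M n e (u @ a # a # v) = 0"
    using e
  proof (induction u arbitrary: e)
    case Nil
    have "pullback M n e (a # a # v) = pullback M n (\<lambda>w. 0) v"
      unfolding two
      by (rule pullback_cong, rule q_Manin_pair_sum(1)[OF q M r _ _ a])
        (simp_all add: diag[OF Nil] swap[OF Nil])
    then show ?case by (simp add: pullback_zero)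
  next
    case (Cons k u)
    then show ?case by (simp add: pullback_Cons[of M n e k] step)
  qed
  show "pullback M n e (u @ a # b # v) = r *\<^sub>C pullback M n e (u @ b # a # v)" if "b < a"
    using e
  proof (induction u arbitrary: e)
    case Nil
    show ?case
      unfolding append_Nil two pullback_scaleC[symmetric]
      by (rule pullback_cong, rule q_Manin_pair_sum(2)[OF q M r _ _ a that])
        (simp_all add: diag[OF Nil] swap[OF Nil])
  next
    case (Cons k u)
    then show ?case by (simp add: pullback_Cons[of M n e k] step)
  qed
qed

lemma q_alternating_pullback:
  fixes M :: "'a::complex_algebra_1 mat"
  assumes "q \<noteq> 0" "M \<in> carrier_mat n n" "q_Manin q M" "q_alternating (inverse (- q)) n e"
  shows "q_alternating (inverse (- q)) n (pullback M n e)"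
  unfolding q_alternating_def
  using pullback_adjacent_columns[OF assms(1-3) refl assms(4)] by auto

text \<open>This is the substitution \<open>\<psi>\<^sub>j = \<Sum>\<^sub>c \<phi>\<^sub>c B\<^sub>c\<^sub>j\<close> in the last factor. The last column is the one
  whose entry of \<open>M\<close> stands next to the entry of \<open>B\<close>, so the sum over \<open>c\<close> produces \<open>M * B\<close> even
  though entries do not commute.\<close>

lemma pullback_snoc_inverse:
  fixes M B :: "'a::complex_algebra_1 mat"
  assumes M: "M \<in> carrier_mat n n" "B \<in> carrier_mat n n" "M * B = 1\<^sub>m n" and j: "j < n"
  shows "(\<Sum>c<n. pullback M n e (C @ [c]) * B $$ (c, j)) = pullback M n (\<lambda>w. e (w @ [j])) C"
proof (induction C arbitrary: e)
  case Nil
  have MB: "(\<Sum>c<n. M $$ (k, c) * B $$ (c, j)) = (if k = j then 1 else 0)" if "k < n" for k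
  proof -
    have "(M * B) $$ (k, j) = (\<Sum>c<n. M $$ (k, c) * B $$ (c, j))"
      using M(1,2) that j by (simp add: scalar_prod_def atLeast0LessThan)
    then show ?thesis using that j unfolding M(3) by simp
  qed
  have "(\<Sum>c<n. pullback M n e ([] @ [c]) * B $$ (c, j))
      = (\<Sum>k<n. \<Sum>c<n. e [k] * (M $$ (k, c) * B $$ (c, j)))"
    by (simp add: pullback_Cons sum_distrib_right mult.assoc) (rule sum.swap)
  also have "\<dots> = (\<Sum>k<n. if k = j then e [k] else 0)"
    by (simp add: sum_distrib_left[symmetric] MB if_distrib cong: if_cong)
  finally show ?case using j by simp
next
  case (Cons d C)
  then show ?case by (simp add: pullback_Cons[of M n _ d])
qed

lemma pullback_append_rev_inverse:
  fixes M B :: "'a::complex_algebra_1 mat"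
  assumes M: "M \<in> carrier_mat n n" "B \<in> carrier_mat n n" "M * B = 1\<^sub>m n"
    and "set J \<subseteq> {..<n}"
  shows "(\<Sum>K\<in>words n (length J). pullback M n e (C @ rev K) * word_prod B K J)
       = pullback M n (\<lambda>w. e (w @ rev J)) C"
  using assms(4)
proof (induction J arbitrary: e)
  case Nil
  then show ?case by (simp add: word_prod_def)
next
  case (Cons j J)
  have "(\<Sum>K\<in>words n (length (j # J)). pullback M n e (C @ rev K) * word_prod B K (j # J))
      = (\<Sum>K\<in>words n (length J).
           (\<Sum>c<n. pullback M n e ((C @ rev K) @ [c]) * B $$ (c, j)) * word_prod B K J)"
    by (simp add: sum_words_Suc word_prod_def sum_distrib_right mult.assoc) (rule sum.swap)
  also have "\<dots> = (\<Sum>K\<in>words n (length J).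
      pullback M n (\<lambda>w. e (w @ [j])) (C @ rev K) * word_prod B K J)"
    using Cons.prems by (simp only: pullback_snoc_inverse[OF M] list.set insert_subset lessThan_iff)
  also have "\<dots> = pullback M n (\<lambda>w. e ((w @ rev J) @ [j])) C"
    using Cons by simp
  finally show ?case by simp
qed

section \<open>Determinants as sums over words\<close>

text \<open>For increasing \<open>R\<close>, permutations of its positions correspond to rearrangements of \<open>R\<close>, with the
  same inversions. In this form a minor can be recognised inside a pullback.\<close>

lemma p_det_multi_submat:
  fixes X :: "'a::complex_algebra_1 mat"
  assumes R: "sorted_wrt (<) R" and len: "length C = length R"
  shows "p_det p (multi_submat X R C)
       = (\<Sum>K | distinct K \<and> set K = set R. (inverse (- p)) ^ inv_count K *\<^sub>C word_prod X K C)"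
proof -
  let ?P = "{\<tau>. \<tau> permutes {0..<length R}}"
  let ?W = "{K. distinct K \<and> set K = set R}"
  have dR: "distinct R" using R by (simp add: strict_sorted_iff)
  have nth: "permute_list \<tau> R ! a = R ! \<tau> a" if "\<tau> \<in> ?P" "a < length R" for \<tau> a
    using that by (simp add: permute_list_nth atLeast0LessThan)
  have lt: "\<tau> a < length R" if "\<tau> \<in> ?P" "a < length R" for \<tau> a
    using permutes_in_image[of \<tau> "{0..<length R}" a] that by simp
  have "inj_on (\<lambda>\<tau>. permute_list \<tau> R) ?P"
  proof (rule inj_onI)
    fix \<sigma> \<tau> assume st: "\<sigma> \<in> ?P" "\<tau> \<in> ?P" and eq: "permute_list \<sigma> R = permute_list \<tau> R"
    show "\<sigma> = \<tau>"
    proof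
      fix a
      show "\<sigma> a = \<tau> a"
      proof (cases "a < length R")
        case True
        then have "R ! \<sigma> a = R ! \<tau> a" using nth[of _ a] st eq by metis
        then show ?thesis using lt[OF st(1) True] lt[OF st(2) True] dR
          by (simp add: nth_eq_iff_index_eq)
      next
        case False
        then show ?thesis using st by (simp add: permutes_def)
      qed
    qed
  qed
  moreover have "(\<lambda>\<tau>. permute_list \<tau> R) ` ?P = ?W"
  proof (intro equalityI subsetI)
    fix K assume "K \<in> (\<lambda>\<tau>. permute_list \<tau> R) ` ?P"
    then show "K \<in> ?W" using dR by (auto simp: atLeast0LessThan)
  next
    fix K assume "K \<in> ?W"
    then have "mset K = mset R" using dR by (simp add: set_eq_iff_mset_eq_distinct[symmetric])
    then show "K \<in> (\<lambda>\<tau>. permute_list \<tau> R) ` ?P"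
      by (auto simp: atLeast0LessThan elim!: mset_eq_permutation)
  qed
  ultimately have bij: "bij_betw (\<lambda>\<tau>. permute_list \<tau> R) ?P ?W" by (rule bij_betw_imageI)
  have "p_det p (multi_submat X R C) =
     (\<Sum>\<tau>\<in>?P. (inverse (- p)) ^ inv_count (permute_list \<tau> R) *\<^sub>C word_prod X (permute_list \<tau> R) C)"
    unfolding p_det_def
  proof (rule sum.cong)
    fix \<tau> assume t: "\<tau> \<in> ?P"
    have "map (\<lambda>j. multi_submat X R C $$ (\<tau> j, j)) [0..<length R]
        = map2 (\<lambda>k c. X $$ (k, c)) (permute_list \<tau> R) C"
      by (rule nth_equalityI) (auto simp: len multi_submat_def nth[OF t] lt[OF t])
    then show "(- p) powi - int (inversions (dim_col (multi_submat X R C)) \<tau>) *\<^sub>C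
        prod_list (map (\<lambda>j. multi_submat X R C $$ (\<tau> j, j)) [0..<dim_col (multi_submat X R C)])
      = (inverse (- p)) ^ inv_count (permute_list \<tau> R) *\<^sub>C word_prod X (permute_list \<tau> R) C"
      using t inv_count_permute_list[OF R, of \<tau>] len
      by (simp add: word_prod_def power_int_minus power_inverse multi_submat_def
          del: inverse_minus_eq)
  qed (simp add: multi_submat_def len)
  also have "\<dots> = (\<Sum>K\<in>?W. (inverse (- p)) ^ inv_count K *\<^sub>C word_prod X K C)"
    by (rule sum.reindex_bij_betw[OF bij])
  finally show ?thesis .
qed


section \<open>Complementary minors\<close>

lemma set_compl_index: "set (compl_index n J) = {..<n} - set J"
  by (auto simp: compl_index_def)

lemma sorted_compl_index: "sorted_wrt (<) (compl_index n J)"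
  unfolding compl_index_def by (rule sorted_wrt_filter) simp

lemma length_compl_index:
  assumes "distinct J" "set J \<subseteq> {..<n}"
  shows "length (compl_index n J) + length J = n"
proof -
  have "length (compl_index n J) = card ({..<n} - set J)"
    using sorted_compl_index by (metis distinct_card set_compl_index strict_sorted_iff)
  moreover have "card (set J) \<le> n" using card_mono[OF _ assms(2)] by simp
  ultimately show ?thesis using assms by (simp add: card_Diff_subset distinct_card)
qed

text \<open>The number of inversions between any word in the letters outside \<open>J\<close> and a word following
  it in the letters of \<open>J\<close>.\<close>

abbreviation cross_inv :: "nat \<Rightarrow> nat list \<Rightarrow> nat" where
  "cross_inv n J \<equiv> \<Sum>x\<in>{..<n} - set J. card {y \<in> set J. y < x}"

lemma distinct_word_append_iff:
  assumes "length U + length V = n" "set U \<subseteq> {..<n}" "set V \<subseteq> {..<n}"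
  shows "distinct (U @ V) \<longleftrightarrow> distinct U \<and> distinct V \<and> set U = {..<n} - set V"
proof
  assume d: "distinct (U @ V)"
  have "set U = {..<n} - set V"
  proof (rule card_subset_eq)
    have "card ({..<n} - set V) = n - length V"
      using assms(3) d by (simp add: card_Diff_subset distinct_card)
    then show "card (set U) = card ({..<n} - set V)"
      using d assms(1) distinct_card[of U] by simp
  qed (use d assms(2) in auto)
  then show "distinct U \<and> distinct V \<and> set U = {..<n} - set V" using d by simp
qed auto

lemma inv_count_append_rev:
  assumes "distinct U" "distinct V" "set U = {..<n} - set V"
  shows "inv_count (U @ rev V) = inv_count U + inv_count (rev V) + cross_inv n V"
  using inv_count_append[of U "rev V"] assms by auto

text \<open>The sign of \<open>K @ rev J\<close> vanishes unless \<open>K\<close> is a rearrangement of the complement of \<open>J\<close>, and then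
  depends on \<open>K\<close> only through \<open>inv_count K\<close>; what remains is the determinant expansion.\<close>

lemma pullback_q_sign_append_rev:
  fixes X :: "'a::complex_algebra_1 mat"
  assumes J: "distinct J" "set J \<subseteq> {..<n}" and len: "length C + length J = n"
  shows "pullback X n (\<lambda>w. q_sign (inverse (- q)) (w @ rev J)) C
       = inverse (- q) ^ (inv_count (rev J) + cross_inv n J) *\<^sub>C
         p_det q (multi_submat X (compl_index n J) C)"
proof -
  define r where "r = inverse (- q)"
  let ?W = "{K. distinct K \<and> set K = {..<n} - set J}"
  have dist: "distinct (K @ rev J) \<longleftrightarrow> K \<in> ?W" if "K \<in> words n (length C)" for K
    using distinct_word_append_iff[of K "rev J" n] that len J by (auto simp: words_def)
  have sub: "?W \<subseteq> words n (length C)"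
  proof
    fix K assume K: "K \<in> ?W"
    have "distinct (compl_index n J)"
      using sorted_compl_index[of n J] by (simp add: strict_sorted_iff)
    then have "length K = length (compl_index n J)"
      using K by (simp add: distinct_card[symmetric] set_compl_index)
    then show "K \<in> words n (length C)"
      using K length_compl_index[OF J] len by (auto simp: words_def)
  qed
  have "pullback X n (\<lambda>w. q_sign r (w @ rev J)) C
      = (\<Sum>K\<in>?W. q_sign r (K @ rev J) * word_prod X K C)"
    unfolding pullback_def
    by (rule sum.mono_neutral_right) (use sub dist in \<open>auto simp: q_sign_def\<close>)
  also have "\<dots> = (\<Sum>K\<in>?W. r ^ (inv_count (rev J) + cross_inv n J) *\<^sub>C
                         (r ^ inv_count K *\<^sub>C word_prod X K C))"
  proof (rule sum.cong[OF refl])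
    fix K assume K: "K \<in> ?W"
    then have "distinct (K @ rev J)" using J by auto
    moreover have "inv_count (K @ rev J) = inv_count K + inv_count (rev J) + cross_inv n J"
      using inv_count_append_rev K J by blast
    ultimately show "q_sign r (K @ rev J) * word_prod X K C
        = r ^ (inv_count (rev J) + cross_inv n J) *\<^sub>C (r ^ inv_count K *\<^sub>C word_prod X K C)"
      by (simp add: q_sign_def mult_scaleC_left scaleC_scaleC power_add mult_ac)
  qed
  also have "\<dots> = r ^ (inv_count (rev J) + cross_inv n J) *\<^sub>C
      p_det q (multi_submat X (compl_index n J) C)"
    using len length_compl_index[OF J]
    by (subst p_det_multi_submat[OF sorted_compl_index])
      (simp_all add: set_compl_index scaleC_sum r_def)
  finally show ?thesis unfolding r_def .
qed

text \<open>A product of \<open>n\<close> factors \<open>\<phi>\<^sub>c\<close> is sorted by the same relations as a product of generators,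
  and \<open>\<phi>\<^sub>0 \<cdots> \<phi>\<^sub>n\<^sub>-\<^sub>1\<close> has top coefficient \<open>det\<^sub>q M\<close>.\<close>

lemma pullback_q_sign_full:
  fixes M :: "'a::complex_algebra_1 mat"
  assumes q: "q \<noteq> 0" and M: "M \<in> carrier_mat n n" "q_Manin q M"
    and D: "D \<in> words n n"
  shows "pullback M n (q_sign (inverse (- q))) D
       = (if distinct D then inverse (- q) ^ inv_count D *\<^sub>C p_det q M else 0)"
proof -
  have "sort D = [0..<n]" if "distinct D"
  proof (rule sorted_distinct_set_unique)
    have "set D = {..<n}"
      using D that by (intro card_subset_eq) (auto simp: words_def distinct_card)
    then show "set (sort D) = set [0..<n]" by (simp add: atLeast0LessThan)
  qed (use that in auto)
  moreover have "pullback M n (q_sign (inverse (- q))) [0..<n] = p_det q M"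
  proof -
    have "multi_submat M [0..<n] [0..<n] = M"
      using M(1) by (intro eq_matI) (auto simp: multi_submat_def)
    moreover have "compl_index n [] = [0..<n]" by (simp add: compl_index_def)
    ultimately show ?thesis
      using pullback_q_sign_append_rev[of "[]" n "[0..<n]" M q] by (simp add: scaleC_one)
  qed
  ultimately show ?thesis
    using q_alternating_sort[OF q_alternating_pullback[OF q M q_alternating_q_sign], of D] D
    by (auto simp: words_def)
qed

text \<open>Replacing the generators in \<open>rev J\<close> gives columns \<open>C @ rev K\<close>, with \<open>C\<close> the complement of
  \<open>I\<close>, and only rearrangements \<open>K\<close> of \<open>I\<close> contribute. Their factor \<open>(- q\<inverse>) ^ inv_count (rev K)\<close> is
  \<open>(- q) ^ inv_count K\<close> up to a constant, because \<open>inv_count (rev K)\<close> and \<open>inv_count K\<close> have a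
  constant sum; these are the signs of the \<open>q\<inverse>\<close>-determinant.\<close>

lemma det_mult_det_inverse_conv_pullback:
  fixes M B :: "'a::complex_algebra_1 mat"
  assumes q: "q \<noteq> 0" and M: "M \<in> carrier_mat n n" "q_Manin q M"
    and B: "B \<in> carrier_mat n n" "M * B = 1\<^sub>m n"
    and I: "sorted_wrt (<) I" "set I \<subseteq> {..<n}"
    and J: "set J \<subseteq> {..<n}" "length J = length I"
  shows "pullback M n (\<lambda>w. q_sign (inverse (- q)) (w @ rev J)) (compl_index n I)
       = inverse (- q) ^ (cross_inv n I + (length I choose 2)) *\<^sub>C
         (p_det q M * p_det (inverse q) (multi_submat B I J))"
proof -
  define r where "r = inverse (- q)"
  have r: "r * (- q) = 1" using q by (simp add: r_def)
  let ?C = "compl_index n I"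
  let ?W = "{K. distinct K \<and> set K = set I}"
  have dI: "distinct I" using I by (simp add: strict_sorted_iff)
  have dC: "distinct ?C" using sorted_compl_index[of n I] by (simp add: strict_sorted_iff)
  have lenC: "length ?C + length I = n" using length_compl_index[OF dI I(2)] .
  have dist: "distinct (?C @ rev K) \<longleftrightarrow> K \<in> ?W" if "K \<in> words n (length J)" for K
  proof -
    have K: "set K \<subseteq> {..<n}" "length K = length I" using that J(2) by (auto simp: words_def)
    then have "{..<n} - set I = {..<n} - set K \<longleftrightarrow> set K = set I" using I(2) by blast
    then show ?thesis
      using distinct_word_append_iff[of ?C "rev K" n] K lenC dC by (simp add: set_compl_index)
  qed
  have lenW: "length K = length I" if "K \<in> ?W" for K
    using that distinct_card[of K] distinct_card[OF dI] by simp
  have sub: "?W \<subseteq> words n (length J)"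
    using lenW I(2) J(2) by (auto simp: words_def)
  have "pullback M n (\<lambda>w. q_sign r (w @ rev J)) ?C
      = (\<Sum>K\<in>words n (length J). pullback M n (q_sign r) (?C @ rev K) * word_prod B K J)"
    using pullback_append_rev_inverse[OF M(1) B J(1)] by simp
  also have "\<dots> = (\<Sum>K\<in>words n (length J).
     (if K \<in> ?W then r ^ inv_count (?C @ rev K) *\<^sub>C p_det q M else 0) * word_prod B K J)"
  proof (rule sum.cong[OF refl])
    fix K assume K: "K \<in> words n (length J)"
    then have "?C @ rev K \<in> words n n"
      using lenC J by (auto simp: words_def set_compl_index)
    from pullback_q_sign_full[OF q M this] dist[OF K]
    show "pullback M n (q_sign r) (?C @ rev K) * word_prod B K J
      = (if K \<in> ?W then r ^ inv_count (?C @ rev K) *\<^sub>C p_det q M else 0) * word_prod B K J"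
      unfolding r_def by simp
  qed
  also have "\<dots> = (\<Sum>K\<in>?W. (r ^ inv_count (?C @ rev K) *\<^sub>C p_det q M) * word_prod B K J)"
    using sub by (intro sum.mono_neutral_cong_right) auto
  also have "\<dots> = (\<Sum>K\<in>?W. r ^ (cross_inv n I + (length I choose 2)) *\<^sub>C
       (p_det q M * ((- q) ^ inv_count K *\<^sub>C word_prod B K J)))"
  proof (rule sum.cong[OF refl])
    fix K assume K: "K \<in> ?W"
    have "inv_count (?C @ rev K) = inv_count (rev K) + cross_inv n I"
      using inv_count_append_rev[OF dC, of K n] K
      by (simp add: set_compl_index inv_count_strict_sorted[OF sorted_compl_index])
    moreover have "inv_count (rev K) + inv_count K = length I choose 2"
      using inv_count_rev[of K] K lenW[OF K] by simp
    ultimately have count: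
      "cross_inv n I + (length I choose 2) = inv_count (?C @ rev K) + inv_count K"
      by linarith
    have "r ^ (cross_inv n I + (length I choose 2)) * (- q) ^ inv_count K
        = r ^ inv_count (?C @ rev K) * (r * (- q)) ^ inv_count K"
      unfolding count power_add power_mult_distrib by (simp only: mult.assoc)
    then show "(r ^ inv_count (?C @ rev K) *\<^sub>C p_det q M) * word_prod B K J
      = r ^ (cross_inv n I + (length I choose 2)) *\<^sub>C
         (p_det q M * ((- q) ^ inv_count K *\<^sub>C word_prod B K J))"
      unfolding r by (simp add: mult_scaleC_left mult_scaleC_right scaleC_scaleC)
  qed
  also have "\<dots> = r ^ (cross_inv n I + (length I choose 2)) *\<^sub>C
       (p_det q M * p_det (inverse q) (multi_submat B I J))"
    by (simp add: p_det_multi_submat[OF I(1) J(2)] scaleC_sum sum_distrib_left)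
  finally show ?thesis unfolding r_def .
qed

text \<open>Both evaluations of the same pullback carry a power of \<open>- q\<inverse>\<close>; the claimed scalar is the
  quotient of the two powers.\<close>

lemma det_mult_det_inverse:
  fixes M B :: "'a::complex_algebra_1 mat"
  assumes q: "q \<noteq> 0" and M: "M \<in> carrier_mat n n" "q_Manin q M"
    and B: "B \<in> carrier_mat n n" "M * B = 1\<^sub>m n"
    and I: "sorted_wrt (<) I" "set I \<subseteq> {..<n}"
    and J: "set J \<subseteq> {..<n}" "length J = length I"
  shows "p_det q M * p_det (inverse q) (multi_submat B I J) =
       ((- q) powi (\<Sum>l<length I. int (J ! l) - int (I ! l)) * eps_qinv q J) *\<^sub>C
         p_det q (multi_submat M (compl_index n J) (compl_index n I))"
proof (cases "distinct J")
  case False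
  then have "pullback M n (\<lambda>w. q_sign (inverse (- q)) (w @ rev J)) (compl_index n I) = 0"
    by (simp add: q_sign_def pullback_zero)
  then have "p_det q M * p_det (inverse q) (multi_submat B I J) = 0"
    using det_mult_det_inverse_conv_pullback[OF assms] q
    by - (rule scaleC_left_cancel[of "inverse (- q) ^ (cross_inv n I + (length I choose 2))"], auto)
  then show ?thesis using False by (simp add: eps_qinv_not_distinct)
next
  case True
  define r where "r = inverse (- q)"
  have r0: "r \<noteq> 0" using q by (simp add: r_def)
  have dI: "distinct I" using I by (simp add: strict_sorted_iff)
  define a where "a = cross_inv n I + (length I choose 2)"
  define b where "b = inv_count (rev J) + cross_inv n J"
  let ?det = "p_det q (multi_submat M (compl_index n J) (compl_index n I))"
  let ?s = "\<Sum>l<length I. int (J ! l) - int (I ! l)"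
  have sum_nth: "(\<Sum>l<length xs. int (xs ! l)) = int (\<Sum>(set xs))" if "distinct xs" for xs
    using that by (simp add: sum_list_distinct_conv_sum_set[of xs "\<lambda>x. x", symmetric]
        sum_list_sum_nth atLeast0LessThan)
  have "?s = int (\<Sum>(set J)) - int (\<Sum>(set I))"
    using sum_nth[OF True] sum_nth[OF dI] J(2) by (simp add: sum_subtractf)
  moreover have "cross_inv n I + \<Sum>(set I) = cross_inv n J + \<Sum>(set J)"
    using sum_card_complement[OF I(2)] sum_card_complement[OF J(1)] J(2)
    by (simp add: distinct_card[OF dI] distinct_card[OF True])
  moreover have "inv_count (rev J) + inv_count J = length I choose 2"
    using inv_count_rev[OF True] J(2) by simp
  ultimately have exponent: "int a = int b + (?s + int (inv_count J))"
    unfolding a_def b_def by linarith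
  have r_pow: "r ^ k = (- q) powi (- int k)" for k
    by (simp add: r_def power_int_minus power_inverse del: inverse_minus_eq)
  have "r ^ b = r ^ a * ((- q) powi ?s * (- q) ^ inv_count J)"
  proof -
    have "r ^ b = (- q) powi (- int a + (?s + int (inv_count J)))"
      unfolding r_pow using exponent by simp
    also have "\<dots> = (- q) powi (- int a) * ((- q) powi ?s * (- q) powi int (inv_count J))"
      using q by (simp only: power_int_add neg_equal_0_iff_equal simp_thms)
    finally show ?thesis unfolding r_pow by simp
  qed
  moreover have "r ^ a *\<^sub>C (p_det q M * p_det (inverse q) (multi_submat B I J)) = r ^ b *\<^sub>C ?det"
    using det_mult_det_inverse_conv_pullback[OF assms]
      pullback_q_sign_append_rev[OF True J(1), of "compl_index n I" M q]
      length_compl_index[OF dI I(2)] J(2)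
    unfolding r_def a_def b_def by simp
  ultimately have "r ^ a *\<^sub>C (p_det q M * p_det (inverse q) (multi_submat B I J))
      = r ^ a *\<^sub>C (((- q) powi ?s * eps_qinv q J) *\<^sub>C ?det)"
    by (simp add: eps_qinv_conv_inv_count[OF True] scaleC_scaleC)
  then show ?thesis by (rule scaleC_left_cancel[rotated]) (simp add: r0)
qed

theorem theorem4p5:
  fixes q :: complex
    and n m :: nat
    and M Minv :: "'a::complex_algebra_1 mat"
    and I J :: "nat list"
  assumes "q \<noteq> 0"
    and "M \<in> carrier_mat n n" and "Minv \<in> carrier_mat n n"
    and "q_Manin q M"
    and "Minv * M = 1\<^sub>m n" and "M * Minv = 1\<^sub>m n"
    and "length I = m" and "set I \<subseteq> {0..<n}" and "sorted_wrt (<) I"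
    and "length J = m" and "set J \<subseteq> {0..<n}"
  shows
    "p_det q M * p_det (inverse q) (multi_submat Minv I J) =
       ((- q) powi (\<Sum>l<m. int (J ! l) - int (I ! l)) * eps_qinv q J) *\<^sub>C
         p_det q (multi_submat M (compl_index n J) (compl_index n I))
     \<and> (sorted_wrt (<) J \<longrightarrow>
         p_det q M * p_det (inverse q) (multi_submat Minv I J) =
           ((- q) powi (\<Sum>l<m. int (J ! l) - int (I ! l))) *\<^sub>C
             p_det q (multi_submat M (compl_index n J) (compl_index n I)))
     \<and> ((\<exists>a<m. \<exists>b<m. a \<noteq> b \<and> J ! a = J ! b) \<longrightarrow>
         p_det q M * p_det (inverse q) (multi_submat Minv I J) = 0)"
  proof (intro conjI impI)
  have J: "set J \<subseteq> {..<n}" "length J = length I" and I: "set I \<subseteq> {..<n}"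
    using assms by (simp_all add: atLeast0LessThan)
  show main: "p_det q M * p_det (inverse q) (multi_submat Minv I J) =
       ((- q) powi (\<Sum>l<m. int (J ! l) - int (I ! l)) * eps_qinv q J) *\<^sub>C
         p_det q (multi_submat M (compl_index n J) (compl_index n I))"
    using det_mult_det_inverse[OF assms(1,2,4,3,6,9) I J] assms(7) by simp
  show "p_det q M * p_det (inverse q) (multi_submat Minv I J) =
           ((- q) powi (\<Sum>l<m. int (J ! l) - int (I ! l))) *\<^sub>C
             p_det q (multi_submat M (compl_index n J) (compl_index n I))"
    if "sorted_wrt (<) J"
  proof -
    have "eps_qinv q J = 1"
      using that by (simp add: eps_qinv_conv_inv_count inv_count_strict_sorted strict_sorted_iff)
    then show ?thesis using main by simp
  qed
  show "p_det q M * p_det (inverse q) (multi_submat Minv I J) = 0"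
    if "\<exists>a<m. \<exists>b<m. a \<noteq> b \<and> J ! a = J ! b"
  proof -
    have "\<not> distinct J" using that assms(10) by (auto simp: distinct_conv_nth)
    then show ?thesis using main by (simp add: eps_qinv_not_distinct)
  qed
qed

end
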